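(* Let $\theta\in(0,\tfrac12)$ and $0<K<r<\infty$, and for each $n$ define the deterministic scalar ($q=1$) signal time series $(y_t)_{1\le t\le n}$ by $$y_t=\begin{cases}\sqrt{1+K+r},&1\le t\le\lfloor\theta n\rfloor,\\ \sqrt{1+K},&\lfloor\theta n\rfloor<t\le\lfloor n/2\rfloor,\\ 1,&\lfloor n/2\rfloor<t\le n.\end{cases}$$ With $\Delta_{\mathrm{within}}(\xi)$, $\Delta_{\mathrm{between}}(\xi)$ and $J_n$ as defined in the context, one has $$\Delta_{\mathrm{within}}(\theta)=K,\quad \Delta_{\mathrm{between}}(\theta)=r,\quad \frac{\Delta_{\mathrm{between}}(\theta)}{\Delta_{\mathrm{within}}(\theta)}=\frac rK,$$ $$\Delta_{\mathrm{within}}(\tfrac12)=r,\quad \Delta_{\mathrm{between}}(\tfrac12)=K,\quad \frac{\Delta_{\mathrm{between}}(\tfrac12)}{\Delta_{\mathrm{within}}(\tfrac12)}=\frac Kr.$$ Moreover, if $$\frac rK=\frac{\Delta_{\mathrm{between}}(\theta)}{\Delta_{\mathrm{within}}(\theta)}<\frac{1}{2\sqrt{\theta(1-\theta)}},$$ then, for every regularization parameter $\varepsilon>0$, the pointwise limit $J_\infty(\nu):=\lim_{n\to\infty}J_n(\nu)$ exists for every $\nu\in(0,1)$ and has a unique minimizer at $\nu=\tfrac12$. In particular, $J_\infty(\tfrac12)<J_\infty(\theta)$.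
   Context: For $0\le a<b\le1$ let $I(a,b)=\{\lfloor an\rfloor+1,\dots,\lfloor bn\rfloor\}$ and, when nonempty, $\widehat\Sigma_{a:b}=\frac1{|I(a,b)|}\sum_{t\in I(a,b)}y_t^2$ (scalar case $q=1$; depends on $n$; the Frobenius norm is then the absolute value). For a candidate split $\xi\in(0,1)$: $\Delta_{\mathrm{within}}(\xi):=\sup\limsup_{n\to\infty}|\widehat\Sigma_{a_1:b_1}-\widehat\Sigma_{a_2:b_2}|$, the supremum over all $(a_1,b_1),(a_2,b_2)$ with either $0\le a_i<b_i\le\xi$ for $i=1,2$, or $\xi\le a_i<b_i\le1$ for $i=1,2$; and $\Delta_{\mathrm{between}}(\xi):=\inf\liminf_{n\to\infty}|\widehat\Sigma_{a_1:b_1}-\widehat\Sigma_{a_2:b_2}|$, the infimum over $0\le a_1<b_1\le\xi$ and $\xi\le a_2<b_2\le1$. For $\varepsilon>0$ and $\nu\in(0,1)$ with $1\le\lfloor\nu n\rfloor\le n-1$, $$J_n(\nu):=\nu\log(\widehat\Sigma_{0:\nu}+\varepsilon)+(1-\nu)\log(\widehat\Sigma_{\nu:1}+\varepsilon).$$ *)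

theory Defs
  imports "HOL-Analysis.Analysis"
begin

text \<open>
  A family of scalar time series, one for every sample size, is a triangular array
  \<open>y :: nat \<Rightarrow> nat \<Rightarrow> real\<close>: \<open>y n t\<close> is the observation at time \<open>t\<close>, for \<open>1 \<le> t \<le> n\<close>.
\<close>

definition time_window :: "nat \<Rightarrow> real \<Rightarrow> real \<Rightarrow> nat set" where
  "time_window n a b = {nat \<lfloor>a * real n\<rfloor> + 1 .. nat \<lfloor>b * real n\<rfloor>}"

text \<open>
  On an empty window the value is the junk \<open>0 / 0 = 0\<close>. For fixed \<open>a < b\<close> the window is
  empty for finitely many \<open>n\<close> only, so this does not affect the limits in \<open>n\<close> below.
\<close>

definition Sigma_hat :: "(nat \<Rightarrow> nat \<Rightarrow> real) \<Rightarrow> nat \<Rightarrow> real \<Rightarrow> real \<Rightarrow> real" where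
  "Sigma_hat y n a b =
     (\<Sum>t\<in>time_window n a b. (y n t)\<^sup>2) / real (card (time_window n a b))"

definition subintervals :: "real \<Rightarrow> real \<Rightarrow> (real \<times> real) set" where
  "subintervals l u = {(a, b). l \<le> a \<and> a < b \<and> b \<le> u}"

text \<open>The extrema are taken in the extended reals, where they always exist.\<close>

definition Delta_within :: "(nat \<Rightarrow> nat \<Rightarrow> real) \<Rightarrow> real \<Rightarrow> ereal" where
  "Delta_within y \<xi> =
     (SUP ((a1, b1), (a2, b2)) \<in> subintervals 0 \<xi> \<times> subintervals 0 \<xi> \<union>
                                 subintervals \<xi> 1 \<times> subintervals \<xi> 1.
        limsup (\<lambda>n. ereal \<bar>Sigma_hat y n a1 b1 - Sigma_hat y n a2 b2\<bar>))"

definition Delta_between :: "(nat \<Rightarrow> nat \<Rightarrow> real) \<Rightarrow> real \<Rightarrow> ereal" where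
  "Delta_between y \<xi> =
     (INF ((a1, b1), (a2, b2)) \<in> subintervals 0 \<xi> \<times> subintervals \<xi> 1.
        liminf (\<lambda>n. ereal \<bar>Sigma_hat y n a1 b1 - Sigma_hat y n a2 b2\<bar>))"

text \<open>
  Meaningful when \<open>1 \<le> \<lfloor>\<nu> n\<rfloor> \<le> n - 1\<close>, which for fixed \<open>\<nu> \<in> (0, 1)\<close> holds for all large \<open>n\<close>.
\<close>

definition split_objective ::
    "(nat \<Rightarrow> nat \<Rightarrow> real) \<Rightarrow> real \<Rightarrow> nat \<Rightarrow> real \<Rightarrow> real" where
  "split_objective y \<epsilon> n \<nu> =
     \<nu> * ln (Sigma_hat y n 0 \<nu> + \<epsilon>) + (1 - \<nu>) * ln (Sigma_hat y n \<nu> 1 + \<epsilon>)"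

definition limit_objective :: "(nat \<Rightarrow> nat \<Rightarrow> real) \<Rightarrow> real \<Rightarrow> real \<Rightarrow> real" where
  "limit_objective y \<epsilon> \<nu> = lim (\<lambda>n. split_objective y \<epsilon> n \<nu>)"

definition three_level_series :: "real \<Rightarrow> real \<Rightarrow> real \<Rightarrow> nat \<Rightarrow> nat \<Rightarrow> real" where
  "three_level_series \<theta> K r n t =
     (if int t \<le> \<lfloor>\<theta> * real n\<rfloor> then sqrt (1 + K + r)
      else if int t \<le> \<lfloor>real n / 2\<rfloor> then sqrt (1 + K)
      else 1)"

end

(* The empirical means converge to window averages of a three-step density, whose within and
   between differences can be read off. The limiting objective is the sum of two perspectives
   x ln (g / x), concave in (x, g), evaluated at the running integral g of the density. As g is
   piecewise linear with kinks at theta and 1/2 only, the objective is concave between the kinks, so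
   that everything reduces to comparing its values at theta and 1/2. For that comparison one
   subtracts the second-order terms: ln (1 + x) + x^2 / 2 is convex for x >= 0 and concave for
   -1 < x <= 0, so Jensen's inequality bounds the gap below by its quadratic part, whose sign is
   exactly the hypothesis on r / K. *)

theory Submission
  imports Defs
begin

section \<open>Limits of empirical window means\<close>

lemma nat_floor_over_n_tendsto:
  assumes "0 \<le> c"
  shows "(\<lambda>n. real (nat \<lfloor>c * real n\<rfloor>) / real n) \<longlonglongrightarrow> c"
proof (rule tendsto_sandwich)
  show "(\<lambda>n. c - 1 / real n) \<longlonglongrightarrow> c"
    by (rule tendsto_eq_intros lim_1_over_n | simp)+
  show "(\<lambda>n. c) \<longlonglongrightarrow> c" by simp
  have bnd: "c * real n - 1 \<le> real (nat \<lfloor>c * real n\<rfloor>)" "real (nat \<lfloor>c * real n\<rfloor>) \<le> c * real n" for n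
    using assms by (auto simp: of_nat_nat)
  show "\<forall>\<^sub>F n in sequentially. c - 1 / real n \<le> real (nat \<lfloor>c * real n\<rfloor>) / real n"
    using eventually_gt_at_top[of 0]
  proof eventually_elim
    case (elim n)
    then have "c - 1 / real n = (c * real n - 1) / real n" by (simp add: field_simps)
    then show ?case using bnd(1)[of n] by (simp add: divide_right_mono)
  qed
  show "\<forall>\<^sub>F n in sequentially. real (nat \<lfloor>c * real n\<rfloor>) / real n \<le> c"
    using eventually_gt_at_top[of 0] by eventually_elim (simp add: pos_divide_le_eq bnd)
qed

lemma sum_indicator_le:
  fixes p q m :: nat
  assumes "p \<le> q"
  shows "(\<Sum>t\<in>{p + 1..q}. if t \<le> m then 1 else 0 :: real) = real (min q m) - real (min p m)"
  using assms by (induction q rule: dec_induct) auto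

text \<open>For \<open>a < b\<close> this is the length of the part of the window below
  \<open>c\<close>, relative to \<open>b - a\<close>. Truncating both end points at \<open>c\<close>
  covers every position of \<open>c\<close> without a case split.\<close>

definition fraction_below :: "real \<Rightarrow> real \<Rightarrow> real \<Rightarrow> real" where
  "fraction_below c a b = (min b c - min a c) / (b - a)"

lemma fraction_below_nonneg: "a < b \<Longrightarrow> 0 \<le> fraction_below c a b"
  by (auto simp: fraction_below_def min_def)

lemma fraction_below_le_1: "a < b \<Longrightarrow> fraction_below c a b \<le> 1"
  by (auto simp: fraction_below_def min_def field_simps)

lemma fraction_below_eq_1: "a < b \<Longrightarrow> b \<le> c \<Longrightarrow> fraction_below c a b = 1"
  by (simp add: fraction_below_def)

lemma fraction_below_eq_0: "c \<le> a \<Longrightarrow> a < b \<Longrightarrow> fraction_below c a b = 0"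
  by (simp add: fraction_below_def)

text \<open>The map from x to the floor of x n is monotone and so commutes with \<open>min\<close>.
  Hence the count below \<open>c\<close> is again a difference of two floors, now at
  \<open>min b c\<close> and \<open>min a c\<close>. Dividing numerator and denominator by n gives
  the limit.\<close>

lemma time_window_fraction_tendsto:
  assumes "0 \<le> a" "a < b" "0 \<le> c"
  shows "(\<lambda>n. (\<Sum>t\<in>time_window n a b. if int t \<le> \<lfloor>c * real n\<rfloor> then 1 else 0 :: real)
                / real (card (time_window n a b))) \<longlonglongrightarrow> fraction_below c a b"
proof -
  define N where "N x n = real (nat \<lfloor>x * real n\<rfloor>)" for x and n :: nat
  have lim: "(\<lambda>n. N x n / real n) \<longlonglongrightarrow> x" if "0 \<le> x" for x
    using nat_floor_over_n_tendsto[OF that] by (simp add: N_def)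
  have floor_mono': "nat \<lfloor>x * real n\<rfloor> \<le> nat \<lfloor>z * real n\<rfloor>" if "x \<le> z" for x z and n :: nat
    using that by (intro nat_mono floor_mono mult_right_mono) auto
  have min_N: "real (min (nat \<lfloor>x * real n\<rfloor>) (nat \<lfloor>c * real n\<rfloor>)) = N (min x c) n" for x n
    using floor_mono'[of x c n] floor_mono'[of c x n] by (auto simp: N_def min_def)
  have num: "(\<Sum>t\<in>time_window n a b. if int t \<le> \<lfloor>c * real n\<rfloor> then 1 else 0 :: real)
      = N (min b c) n - N (min a c) n" for n
  proof -
    have "int t \<le> \<lfloor>c * real n\<rfloor> \<longleftrightarrow> t \<le> nat \<lfloor>c * real n\<rfloor>" for t
      using assms by (simp add: le_nat_iff)
    then show ?thesis
      using sum_indicator_le[OF floor_mono'[of a b n]] assms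
      by (simp add: time_window_def flip: min_N)
  qed
  have den: "real (card (time_window n a b)) = N b n - N a n" for n
    using floor_mono'[of a b n] assms by (simp add: time_window_def N_def of_nat_diff)
  have "(\<lambda>n. (N (min b c) n / n - N (min a c) n / n) / (N b n / n - N a n / n))
      \<longlonglongrightarrow> fraction_below c a b"
    unfolding fraction_below_def using assms by (intro tendsto_intros lim) auto
  moreover have "\<forall>\<^sub>F n in sequentially.
      (N (min b c) n / n - N (min a c) n / n) / (N b n / n - N a n / n)
      = (N (min b c) n - N (min a c) n) / (N b n - N a n)"
    using eventually_gt_at_top[of 0]
    by eventually_elim (simp flip: diff_divide_distrib)
  ultimately show ?thesis
    unfolding num den by (simp add: tendsto_cong)
qed

text \<open>The squared series is a stack of three layers: height 1 everywhere, height
  \<open>K\<close> up to time 1/2 and height \<open>r\<close> up to \<theta>. Each layer contributes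
  its height times the share of the window that it covers.\<close>

definition limit_mean :: "real \<Rightarrow> real \<Rightarrow> real \<Rightarrow> real \<Rightarrow> real \<Rightarrow> real" where
  "limit_mean \<theta> K r a b = 1 + K * fraction_below (1 / 2) a b + r * fraction_below \<theta> a b"

lemma Sigma_hat_three_level_tendsto:
  assumes "0 < \<theta>" "\<theta> < 1 / 2" "0 < K" "0 < r" "0 \<le> a" "a < b"
  shows "(\<lambda>n. Sigma_hat (three_level_series \<theta> K r) n a b) \<longlonglongrightarrow> limit_mean \<theta> K r a b"
proof -
  let ?D = "\<lambda>c n t. if int t \<le> \<lfloor>c * real n\<rfloor> then 1 else 0 :: real"
  let ?W = "\<lambda>n. time_window n a b"
  have sq: "(three_level_series \<theta> K r n t)\<^sup>2 = 1 + K * ?D (1 / 2) n t + r * ?D \<theta> n t" for n t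
  proof -
    have "\<lfloor>\<theta> * real n\<rfloor> \<le> \<lfloor>real n / 2\<rfloor>"
      using mult_right_mono[of \<theta> "1 / 2" "real n"] assms by (intro floor_mono) auto
    then show ?thesis
      using assms by (auto simp: three_level_series_def)
  qed
  \<comment> \<open>The constant layer is written as the indicator of the times up to
    \<open>b\<close>, so one limit lemma serves all three layers. The decomposition of
    \<open>Sigma_hat\<close> then holds for every n, even on an empty window, where the mean of 1
    would be the default value 0.\<close>
  have one: "?D b n t = 1" if "t \<in> ?W n" for n t
    using that by (auto simp: time_window_def le_nat_iff)
  have "(\<lambda>n. (\<Sum>t\<in>?W n. ?D b n t) / card (?W n)
           + K * ((\<Sum>t\<in>?W n. ?D (1 / 2) n t) / card (?W n))
           + r * ((\<Sum>t\<in>?W n. ?D \<theta> n t) / card (?W n)))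
        \<longlonglongrightarrow> fraction_below b a b + K * fraction_below (1 / 2) a b + r * fraction_below \<theta> a b"
    using assms by (intro tendsto_intros time_window_fraction_tendsto) auto
  moreover have "Sigma_hat (three_level_series \<theta> K r) n a b
      = (\<Sum>t\<in>?W n. ?D b n t) / card (?W n)
           + K * ((\<Sum>t\<in>?W n. ?D (1 / 2) n t) / card (?W n))
           + r * ((\<Sum>t\<in>?W n. ?D \<theta> n t) / card (?W n))" for n
  proof -
    have "(\<Sum>t\<in>?W n. (three_level_series \<theta> K r n t)\<^sup>2)
        = (\<Sum>t\<in>?W n. ?D b n t + K * ?D (1 / 2) n t + r * ?D \<theta> n t)"
      by (intro sum.cong refl) (simp only: sq one)
    then show ?thesis
      unfolding Sigma_hat_def
      by (simp only: sum.distrib add_divide_distrib sum_distrib_left[symmetric] times_divide_eq_right)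
  qed
  ultimately show ?thesis
    using assms by (simp add: limit_mean_def fraction_below_eq_1)
qed

section \<open>Extrema of limiting differences\<close>

text \<open>Since the means converge, every limsup is a limit. Means on one side lie in an interval
  of length \<open>d\<close>, so two of them differ by at most \<open>d\<close>, and the given pair
  attains this. The two intervals share only their length, not their position.\<close>

lemma Delta_within_eq:
  assumes lim: "\<And>a b. 0 \<le> a \<Longrightarrow> a < b \<Longrightarrow> (\<lambda>n. Sigma_hat y n a b) \<longlonglongrightarrow> S a b"
    and "0 \<le> \<xi>"
    and left: "\<And>a b. 0 \<le> a \<Longrightarrow> a < b \<Longrightarrow> b \<le> \<xi> \<Longrightarrow> S a b \<in> {l..l + d}"
    and right: "\<And>a b. \<xi> \<le> a \<Longrightarrow> a < b \<Longrightarrow> b \<le> 1 \<Longrightarrow> S a b \<in> {u..u + d}"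
    and mem: "((a1, b1), (a2, b2)) \<in> subintervals 0 \<xi> \<times> subintervals 0 \<xi> \<union>
                                       subintervals \<xi> 1 \<times> subintervals \<xi> 1"
    and attained: "\<bar>S a1 b1 - S a2 b2\<bar> = d"
  shows "Delta_within y \<xi> = ereal d"
proof -
  have L: "limsup (\<lambda>n. ereal \<bar>Sigma_hat y n a b - Sigma_hat y n a' b'\<bar>) = ereal \<bar>S a b - S a' b'\<bar>"
    if "0 \<le> a" "a < b" "0 \<le> a'" "a' < b'" for a b a' b'
    using that by (intro lim_imp_Limsup tendsto_intros lim) auto
  show ?thesis
    unfolding Delta_within_def
  proof (rule antisym)
    show "(SUP ((a1, b1), (a2, b2)) \<in> subintervals 0 \<xi> \<times> subintervals 0 \<xi> \<union>
              subintervals \<xi> 1 \<times> subintervals \<xi> 1.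
            limsup (\<lambda>n. ereal \<bar>Sigma_hat y n a1 b1 - Sigma_hat y n a2 b2\<bar>)) \<le> ereal d"
    proof (rule SUP_least, clarify)
      fix a b a' b'
      assume "((a, b), (a', b')) \<in> subintervals 0 \<xi> \<times> subintervals 0 \<xi> \<union>
              subintervals \<xi> 1 \<times> subintervals \<xi> 1"
      then consider "0 \<le> a" "a < b" "b \<le> \<xi>" "0 \<le> a'" "a' < b'" "b' \<le> \<xi>"
        | "\<xi> \<le> a" "a < b" "b \<le> 1" "\<xi> \<le> a'" "a' < b'" "b' \<le> 1"
        by (auto simp: subintervals_def)
      then show "limsup (\<lambda>n. ereal \<bar>Sigma_hat y n a b - Sigma_hat y n a' b'\<bar>) \<le> ereal d"
      proof cases
        case 1
        then show ?thesis using left[of a b] left[of a' b'] by (simp add: L abs_le_iff)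
      next
        case 2
        then show ?thesis using right[of a b] right[of a' b'] \<open>0 \<le> \<xi>\<close> by (simp add: L abs_le_iff)
      qed
    qed
    have "0 \<le> a1" "a1 < b1" "0 \<le> a2" "a2 < b2"
      using mem \<open>0 \<le> \<xi>\<close> by (auto simp: subintervals_def)
    then show "ereal d \<le> (SUP ((a1, b1), (a2, b2)) \<in> subintervals 0 \<xi> \<times> subintervals 0 \<xi> \<union>
              subintervals \<xi> 1 \<times> subintervals \<xi> 1.
            limsup (\<lambda>n. ereal \<bar>Sigma_hat y n a1 b1 - Sigma_hat y n a2 b2\<bar>))"
      by (intro SUP_upper2[OF mem]) (simp add: L attained)
  qed
qed

text \<open>The level \<open>u\<close> and the level \<open>u + d\<close> separate the two sides, so
  every left mean exceeds every right mean by at least \<open>d\<close>; the given pair shows that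
  the bound is sharp.\<close>

lemma Delta_between_eq:
  assumes lim: "\<And>a b. 0 \<le> a \<Longrightarrow> a < b \<Longrightarrow> (\<lambda>n. Sigma_hat y n a b) \<longlonglongrightarrow> S a b"
    and "0 \<le> \<xi>"
    and left: "\<And>a b. 0 \<le> a \<Longrightarrow> a < b \<Longrightarrow> b \<le> \<xi> \<Longrightarrow> u + d \<le> S a b"
    and right: "\<And>a b. \<xi> \<le> a \<Longrightarrow> a < b \<Longrightarrow> b \<le> 1 \<Longrightarrow> S a b \<le> u"
    and mem: "((a1, b1), (a2, b2)) \<in> subintervals 0 \<xi> \<times> subintervals \<xi> 1"
    and attained: "\<bar>S a1 b1 - S a2 b2\<bar> = d"
  shows "Delta_between y \<xi> = ereal d"
proof -
  have L: "liminf (\<lambda>n. ereal \<bar>Sigma_hat y n a b - Sigma_hat y n a' b'\<bar>) = ereal \<bar>S a b - S a' b'\<bar>"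
    if "0 \<le> a" "a < b" "0 \<le> a'" "a' < b'" for a b a' b'
    using that by (intro lim_imp_Liminf tendsto_intros lim) auto
  show ?thesis
    unfolding Delta_between_def
  proof (rule antisym)
    show "ereal d \<le> (INF ((a1, b1), (a2, b2)) \<in> subintervals 0 \<xi> \<times> subintervals \<xi> 1.
            liminf (\<lambda>n. ereal \<bar>Sigma_hat y n a1 b1 - Sigma_hat y n a2 b2\<bar>))"
    proof (rule INF_greatest, clarify)
      fix a b a' b'
      assume "(a, b) \<in> subintervals 0 \<xi>" "(a', b') \<in> subintervals \<xi> 1"
      then show "ereal d \<le> liminf (\<lambda>n. ereal \<bar>Sigma_hat y n a b - Sigma_hat y n a' b'\<bar>)"
        using left[of a b] right[of a' b'] \<open>0 \<le> \<xi>\<close> by (simp add: L subintervals_def)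
    qed
    have "0 \<le> a1" "a1 < b1" "0 \<le> a2" "a2 < b2"
      using mem \<open>0 \<le> \<xi>\<close> by (auto simp: subintervals_def)
    then show "(INF ((a1, b1), (a2, b2)) \<in> subintervals 0 \<xi> \<times> subintervals \<xi> 1.
            liminf (\<lambda>n. ereal \<bar>Sigma_hat y n a1 b1 - Sigma_hat y n a2 b2\<bar>)) \<le> ereal d"
      by (intro INF_lower2[OF mem]) (simp add: L attained)
  qed
qed

section \<open>Concavity of the perspective of the logarithm\<close>

text \<open>At \<open>x = 0\<close> the factor \<open>x\<close> makes the value 0 regardless of the
  logarithm. This agrees with the limit for x decreasing to 0 at fixed positive g, so the degenerate
  splits 0 and 1 can be used as end points.\<close>

definition log_perspective :: "real \<Rightarrow> real \<Rightarrow> real" where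
  "log_perspective x g = x * ln (g / x)"

text \<open>The tangent bound exhibits the perspective as a pointwise infimum of linear functions of
  \<open>(x, g)\<close>, hence as a concave function.\<close>

lemma log_perspective_le:
  assumes "0 \<le> x" "0 \<le> g" "0 < x \<Longrightarrow> 0 < g" "0 < M"
  shows "log_perspective x g \<le> x * (ln M - 1) + g / M"
proof (cases "x = 0")
  case False
  then have "0 < x" "0 < g" using assms by auto
  \<comment> \<open>This is the tangent line of \<open>ln\<close> at \<open>M\<close>, evaluated at
    \<open>g / x\<close>.\<close>
  then have "ln (g / x / M) \<le> g / x / M - 1"
    using \<open>0 < M\<close> by (intro ln_le_minus_one) auto
  then have "x * (ln (g / x) - ln M) \<le> x * (g / x / M - 1)"
    using \<open>0 < x\<close> \<open>0 < g\<close> \<open>0 < M\<close> by (intro mult_left_mono) (auto simp: ln_div ln_mult_pos)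
  then show ?thesis
    using \<open>0 < x\<close> by (simp add: log_perspective_def right_diff_distrib)
qed (use assms in \<open>simp add: log_perspective_def\<close>)

text \<open>The tangent bound is applied to both points with the same \<open>M\<close>, the ratio of
  the combined point, where the bound is an equality. By homogeneity the weights need not sum to 1;
  weights 1 and 1 give superadditivity.\<close>

lemma log_perspective_concave:
  assumes "0 \<le> x" "0 \<le> g" "0 < x \<Longrightarrow> 0 < g" "0 \<le> x'" "0 \<le> g'" "0 < x' \<Longrightarrow> 0 < g'"
    and "0 \<le> s" "0 \<le> t"
    and pos: "0 < s * x + t * x'" "0 < s * g + t * g'"
  shows "s * log_perspective x g + t * log_perspective x' g'
         \<le> log_perspective (s * x + t * x') (s * g + t * g')"
proof -
  define X G where "X = s * x + t * x'" and "G = s * g + t * g'"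
  define M where "M = G / X"
  have "0 < X" "0 < G" "0 < M" using pos by (auto simp: X_def G_def M_def)
  have "s * log_perspective x g + t * log_perspective x' g'
      \<le> s * (x * (ln M - 1) + g / M) + t * (x' * (ln M - 1) + g' / M)"
    using assms \<open>0 < M\<close> by (intro add_mono mult_left_mono log_perspective_le) auto
  also have "\<dots> = X * (ln M - 1) + G / M"
    unfolding X_def G_def by (simp add: algebra_simps add_divide_distrib)
  also have "\<dots> = log_perspective X G"
    using \<open>0 < X\<close> \<open>0 < G\<close> by (simp add: M_def log_perspective_def right_diff_distrib)
  finally show ?thesis by (simp add: X_def G_def)
qed

section \<open>Jensen with a second-order correction\<close>

text \<open>The added square cancels the second-order term of \<open>ln (1 + x)\<close> at 0. The
  second derivative therefore vanishes at 0 and changes sign there, which separates the convex range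
  from the concave one.\<close>

lemma ln_plus_square_second_derivative:
  fixes x :: real
  assumes "-1 < x"
  shows "((\<lambda>x. ln (1 + x) + x\<^sup>2 / 2) has_real_derivative (1 / (1 + x) + x)) (at x)"
    and "((\<lambda>x. 1 / (1 + x) + x) has_real_derivative (1 - 1 / (1 + x)\<^sup>2)) (at x)"
  using assms by (auto intro!: derivative_eq_intros simp: power2_eq_square field_simps)

lemma ln_plus_square_convex: "convex_on {0..} (\<lambda>x::real. ln (1 + x) + x\<^sup>2 / 2)"
proof (rule f''_ge0_imp_convex)
  show "0 \<le> 1 - 1 / (1 + x)\<^sup>2" if "x \<in> {0..}" for x :: real
    using that by (simp add: one_le_power)
qed (auto intro: ln_plus_square_second_derivative)

lemma ln_plus_square_concave: "concave_on {-1<..0} (\<lambda>x::real. ln (1 + x) + x\<^sup>2 / 2)"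
  unfolding concave_on_def
proof (rule f''_ge0_imp_convex)
  show "((\<lambda>x. - (ln (1 + x) + x\<^sup>2 / 2)) has_real_derivative - (1 / (1 + x) + x)) (at x)"
    if "x \<in> {-1<..0}" for x :: real
    using that by (intro DERIV_minus ln_plus_square_second_derivative) auto
  show "((\<lambda>x. - (1 / (1 + x) + x)) has_real_derivative - (1 - 1 / (1 + x)\<^sup>2)) (at x)"
    if "x \<in> {-1<..0}" for x :: real
    using that by (intro DERIV_minus ln_plus_square_second_derivative) auto
  show "0 \<le> - (1 - 1 / (1 + x)\<^sup>2)" if "x \<in> {-1<..0}" for x :: real
    using that by (simp add: power_le_one)
qed auto

text \<open>Measured in units of the middle level, the three levels are 1 + \<rho>, 1 and 1 - k. The
  left side is then the cost of the split at 1/2, the right side that of the split at \<theta>. Each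
  mixed segment averages the middle level with one other level, so Jensen at 0 and \<rho>, and at 0
  and -k, compares the two costs up to squares.\<close>

lemma ln_split_gap:
  fixes \<theta> \<rho> k :: real
  assumes "0 < \<theta>" "\<theta> < 1 / 2" "0 < \<rho>" "0 < k" "k < 1"
    and less: "4 * \<theta> * (1 - \<theta>) * \<rho>\<^sup>2 < k\<^sup>2"
  shows "ln (1 + 2 * \<theta> * \<rho>) / 2 + ln (1 - k) / 2
         < \<theta> * ln (1 + \<rho>) + (1 - \<theta>) * ln (1 - k / (2 * (1 - \<theta>)))"
proof -
  define g where "g x = ln (1 + x) + x\<^sup>2 / 2" for x :: real
  \<comment> \<open>The share of the segment from \<theta> to 1 that is occupied by the lowest
    level.\<close>
  define p where "p = 1 / (2 * (1 - \<theta>))"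
  have p: "0 < p" "p < 1" "(1 - \<theta>) * p = 1 / 2" using assms by (auto simp: p_def field_simps)
  \<comment> \<open>The first half has the high level with weight 2 \<theta> and the middle level
    with the remaining weight.\<close>
  have "g ((1 - 2 * \<theta>) *\<^sub>R 0 + (2 * \<theta>) *\<^sub>R \<rho>) \<le> (1 - 2 * \<theta>) * g 0 + (2 * \<theta>) * g \<rho>"
    unfolding g_def using assms by (intro convex_onD[OF ln_plus_square_convex]) auto
  then have 1: "ln (1 + 2 * \<theta> * \<rho>) / 2 + \<theta>\<^sup>2 * \<rho>\<^sup>2 \<le> \<theta> * ln (1 + \<rho>) + \<theta> * \<rho>\<^sup>2 / 2"
    by (simp add: g_def power_mult_distrib algebra_simps)
  have "(1 - p) * g 0 + p * g (- k) \<le> g ((1 - p) *\<^sub>R 0 + p *\<^sub>R (- k))"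
    unfolding g_def using assms p by (intro concave_onD[OF ln_plus_square_concave]) auto
  then have "(1 - \<theta>) * (p * g (- k)) \<le> (1 - \<theta>) * g (- (p * k))"
    using assms by (intro mult_left_mono) (auto simp: g_def)
  then have "(1 - \<theta>) * p * (ln (1 - k) + k\<^sup>2 / 2)
      \<le> (1 - \<theta>) * ln (1 - p * k) + ((1 - \<theta>) * p) * (p * k\<^sup>2 / 2)"
    by (simp add: g_def algebra_simps power2_eq_square)
  then have 2: "ln (1 - k) / 2 + k\<^sup>2 / 4 \<le> (1 - \<theta>) * ln (1 - p * k) + p * k\<^sup>2 / 4"
    unfolding p(3) by simp
  \<comment> \<open>Given \<open>1\<close> and \<open>2\<close>, it remains to show \<theta> (1 - 2
    \<theta>) \<rho>^2 / 2 < (1 - p) k^2 / 4. Because 1 - p = (1 - 2 \<theta>) p, the common factor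
    1 - 2 \<theta> cancels and leaves 2 \<theta> \<rho>^2 < p k^2, which is the hypothesis
    multiplied by p.\<close>
  have "p * (2 * (1 - \<theta>) * \<rho>\<^sup>2 * (2 * \<theta>)) < p * k\<^sup>2"
    using less p by (intro mult_strict_left_mono) (auto simp: algebra_simps)
  then have "((1 - \<theta>) * p) * (4 * \<theta> * \<rho>\<^sup>2) < p * k\<^sup>2" by (simp add: algebra_simps)
  then have "2 * \<theta> * \<rho>\<^sup>2 < p * k\<^sup>2" unfolding p(3) by simp
  then have "(1 - 2 * \<theta>) * (2 * \<theta> * \<rho>\<^sup>2) < (1 - 2 * \<theta>) * (p * k\<^sup>2)"
    using assms by (intro mult_strict_left_mono) auto
  also have "(1 - 2 * \<theta>) * (p * k\<^sup>2) = (2 * ((1 - \<theta>) * p) - p) * k\<^sup>2"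
    by (simp add: algebra_simps)
  also have "\<dots> = (1 - p) * k\<^sup>2" unfolding p(3) by simp
  finally have "\<theta> * \<rho>\<^sup>2 / 2 - \<theta>\<^sup>2 * \<rho>\<^sup>2 < k\<^sup>2 / 4 - p * k\<^sup>2 / 4"
    by (simp add: algebra_simps power2_eq_square)
  with 1 2 have "ln (1 + 2 * \<theta> * \<rho>) / 2 + ln (1 - k) / 2
      < \<theta> * ln (1 + \<rho>) + (1 - \<theta>) * ln (1 - p * k)" by linarith
  then show ?thesis by (simp add: p_def)
qed

section \<open>The limiting cost and its minimizer\<close>

text \<open>For nonnegative \<open>x\<close>, the integral from 0 to \<open>x\<close> of the
  limiting squared signal plus \<epsilon>. Including \<epsilon> in the density makes each
  regularized mean a difference quotient.\<close>

definition three_level_integral :: "real \<Rightarrow> real \<Rightarrow> real \<Rightarrow> real \<Rightarrow> real \<Rightarrow> real" where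
  "three_level_integral \<theta> K r \<epsilon> x = (1 + \<epsilon>) * x + K * min x (1 / 2) + r * min x \<theta>"

definition split_cost :: "real \<Rightarrow> real \<Rightarrow> real \<Rightarrow> real \<Rightarrow> real \<Rightarrow> real" where
  "split_cost \<theta> K r \<epsilon> \<nu> =
     log_perspective \<nu> (three_level_integral \<theta> K r \<epsilon> \<nu>) +
     log_perspective (1 - \<nu>) (three_level_integral \<theta> K r \<epsilon> 1 - three_level_integral \<theta> K r \<epsilon> \<nu>)"

text \<open>The density is at least 1 + \<epsilon>; this keeps the arguments of all logarithms
  positive.\<close>

lemma three_level_integral_mono:
  assumes "0 < \<epsilon>" "0 < K" "0 < r" "x \<le> z"
  shows "(1 + \<epsilon>) * (z - x) \<le> three_level_integral \<theta> K r \<epsilon> z - three_level_integral \<theta> K r \<epsilon> x"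
proof -
  have "K * min x (1 / 2) \<le> K * min z (1 / 2)" "r * min x \<theta> \<le> r * min z \<theta>"
    using assms by (auto intro!: mult_left_mono)
  then show ?thesis by (simp add: three_level_integral_def algebra_simps)
qed

text \<open>Where the integral is affine, both arguments of both perspectives move affinely with the
  split, so concavity of the perspectives carries over. The end points 0 and 1 are allowed.\<close>

lemma split_cost_concave:
  assumes "0 < \<epsilon>" "0 < K" "0 < r" "0 \<le> \<theta>"
    and "0 \<le> p" "p < q" "q \<le> 1" "0 < s" "0 < t" "s + t = 1"
    and affine: "three_level_integral \<theta> K r \<epsilon> (s * p + t * q)
      = s * three_level_integral \<theta> K r \<epsilon> p + t * three_level_integral \<theta> K r \<epsilon> q"
  shows "s * split_cost \<theta> K r \<epsilon> p + t * split_cost \<theta> K r \<epsilon> q \<le> split_cost \<theta> K r \<epsilon> (s * p + t * q)"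
proof -
  let ?G = "three_level_integral \<theta> K r \<epsilon>"
  have G0: "?G 0 = 0" using assms by (simp add: three_level_integral_def)
  have lower: "(1 + \<epsilon>) * x \<le> ?G x" if "0 \<le> x" for x
    using three_level_integral_mono[of \<epsilon> K r 0 x \<theta>] assms that by (simp add: G0)
  have upper: "(1 + \<epsilon>) * (1 - x) \<le> ?G 1 - ?G x" if "x \<le> 1" for x
    using three_level_integral_mono[of \<epsilon> K r x 1 \<theta>] assms that by simp
  have pos: "0 < (1 + \<epsilon>) * x" if "0 < x" for x using that assms by simp
  have nonneg: "0 \<le> (1 + \<epsilon>) * x" if "0 \<le> x" for x using that assms by simp
  have Gp: "0 \<le> ?G p" "0 < p \<Longrightarrow> 0 < ?G p" "0 < ?G q" "0 < q"
    and Gq: "0 \<le> ?G 1 - ?G q" "0 < 1 - q \<Longrightarrow> 0 < ?G 1 - ?G q" "0 < ?G 1 - ?G p" "0 < 1 - p"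
    using lower[of p] lower[of q] upper[of p] upper[of q] pos[of p] pos[of q] pos[of "1 - p"]
      pos[of "1 - q"] nonneg[of p] nonneg[of "1 - q"] assms by linarith+
  have t: "t = 1 - s" using assms by simp
  have "s * log_perspective p (?G p) + t * log_perspective q (?G q)
      \<le> log_perspective (s * p + t * q) (s * ?G p + t * ?G q)"
    using assms Gp by (intro log_perspective_concave add_nonneg_pos mult_pos_pos mult_nonneg_nonneg) auto
  moreover have "s * log_perspective (1 - p) (?G 1 - ?G p) + t * log_perspective (1 - q) (?G 1 - ?G q)
      \<le> log_perspective (s * (1 - p) + t * (1 - q)) (s * (?G 1 - ?G p) + t * (?G 1 - ?G q))"
    using assms Gq by (intro log_perspective_concave add_pos_nonneg mult_pos_pos mult_nonneg_nonneg) auto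
  moreover have "s * (1 - p) + t * (1 - q) = 1 - (s * p + t * q)"
    "s * (?G 1 - ?G p) + t * (?G 1 - ?G q) = ?G 1 - (s * ?G p + t * ?G q)"
    unfolding t by (simp_all add: algebra_simps)
  ultimately show ?thesis
    unfolding split_cost_def affine by (simp add: distrib_left)
qed

text \<open>Factoring the middle level \<open>B\<close> out of every logarithm adds the same
  \<open>ln B\<close> to both costs, as the weights sum to 1. What remains is
  \<open>ln_split_gap\<close> at \<open>r / B\<close> and \<open>K / B\<close>, whose hypothesis is
  unchanged by this scaling.\<close>

lemma split_cost_half_less_theta:
  assumes "0 < \<theta>" "\<theta> < 1 / 2" "0 < K" "0 < r" "0 < \<epsilon>"
    and less: "4 * \<theta> * (1 - \<theta>) * r\<^sup>2 < K\<^sup>2"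
  shows "split_cost \<theta> K r \<epsilon> (1 / 2) < split_cost \<theta> K r \<epsilon> \<theta>"
proof -
  define B where "B = 1 + \<epsilon> + K"
  have B: "0 < B" "K < B" using assms by (auto simp: B_def)
  have half: "split_cost \<theta> K r \<epsilon> (1 / 2)
      = ln (B * (1 + 2 * \<theta> * (r / B))) / 2 + ln (B * (1 - K / B)) / 2"
  proof -
    have "three_level_integral \<theta> K r \<epsilon> (1 / 2) / (1 / 2) = B * (1 + 2 * \<theta> * (r / B))"
      "(three_level_integral \<theta> K r \<epsilon> 1 - three_level_integral \<theta> K r \<epsilon> (1 / 2)) / (1 - 1 / 2)
        = B * (1 - K / B)"
      using assms B by (simp_all add: three_level_integral_def field_simps) (simp_all add: B_def algebra_simps)
    then show ?thesis
      by (simp only: split_cost_def log_perspective_def) simp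
  qed
  have "three_level_integral \<theta> K r \<epsilon> \<theta> / \<theta> = B * (1 + r / B)"
    "(three_level_integral \<theta> K r \<epsilon> 1 - three_level_integral \<theta> K r \<epsilon> \<theta>) / (1 - \<theta>)
      = B * (1 - K / B / (2 * (1 - \<theta>)))"
    using assms B by (simp_all add: three_level_integral_def field_simps) (simp_all add: B_def algebra_simps)
  then have theta: "split_cost \<theta> K r \<epsilon> \<theta>
      = \<theta> * ln (B * (1 + r / B)) + (1 - \<theta>) * ln (B * (1 - K / B / (2 * (1 - \<theta>))))"
    by (simp only: split_cost_def log_perspective_def)
  have "4 * \<theta> * (1 - \<theta>) * (r / B)\<^sup>2 < (K / B)\<^sup>2"
    using less B by (simp add: power_divide divide_strict_right_mono)
  then have gap: "ln (1 + 2 * \<theta> * (r / B)) / 2 + ln (1 - K / B) / 2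
      < \<theta> * ln (1 + r / B) + (1 - \<theta>) * ln (1 - K / B / (2 * (1 - \<theta>)))"
    using assms B by (intro ln_split_gap) auto
  \<comment> \<open>Positivity of the mean after \<theta>, from \<open>K < B\<close> and 2 (1 -
    \<theta>) > 1.\<close>
  have "K * 1 < B * (2 * (1 - \<theta>))" using assms B by (intro mult_strict_mono) auto
  then have "0 < 1 - K / B / (2 * (1 - \<theta>))" using assms B by (simp add: field_simps)
  moreover have "0 < 1 + 2 * \<theta> * (r / B)" "0 < 1 - K / B" "0 < 1 + r / B"
    using assms B by (auto intro!: add_pos_pos simp: field_simps)
  moreover have "ln (B * z) = ln B + ln z" if "0 < z" for z
    using B that by (simp add: ln_mult_pos)
  moreover have "\<theta> * (ln B + u) + (1 - \<theta>) * (ln B + v) = ln B + (\<theta> * u + (1 - \<theta>) * v)" for u v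
    by (simp add: algebra_simps)
  ultimately have "split_cost \<theta> K r \<epsilon> (1 / 2)
      = ln B + (ln (1 + 2 * \<theta> * (r / B)) / 2 + ln (1 - K / B) / 2)"
    "split_cost \<theta> K r \<epsilon> \<theta>
      = ln B + (\<theta> * ln (1 + r / B) + (1 - \<theta>) * ln (1 - K / B / (2 * (1 - \<theta>))))"
    unfolding half theta by (simp_all only: add_divide_distrib)
  then show ?thesis
    using gap by simp
qed

text \<open>Between consecutive points of \<open>0, \<theta>, 1 / 2, 1\<close> the cost is concave, so it exceeds the smaller
  of its end point values.\<close>

lemma split_cost_half_less:
  assumes "0 < \<theta>" "\<theta> < 1 / 2" "0 < K" "0 < r" "0 < \<epsilon>"
    and less: "split_cost \<theta> K r \<epsilon> (1 / 2) < split_cost \<theta> K r \<epsilon> \<theta>"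
    and \<nu>: "0 < \<nu>" "\<nu> < 1" "\<nu> \<noteq> 1 / 2"
  shows "split_cost \<theta> K r \<epsilon> (1 / 2) < split_cost \<theta> K r \<epsilon> \<nu>"
proof -
  let ?J = "split_cost \<theta> K r \<epsilon>" and ?G = "three_level_integral \<theta> K r \<epsilon>"
  have "?J 0 = log_perspective 1 (?G 1)" "?J 1 = log_perspective 1 (?G 1)"
    using assms by (simp_all add: split_cost_def log_perspective_def three_level_integral_def)
  \<comment> \<open>Superadditivity of the perspective: splitting never raises the cost above that
    of the whole interval, which is the cost at 0 and at 1.\<close>
  moreover have "?J \<theta> \<le> log_perspective 1 (?G 1)"
  proof -
    have "0 < (1 + \<epsilon>) * \<theta>" "0 < (1 + \<epsilon>) * (1 - \<theta>)" using assms by simp_all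
    moreover have "(1 + \<epsilon>) * \<theta> \<le> ?G \<theta>" "(1 + \<epsilon>) * (1 - \<theta>) \<le> ?G 1 - ?G \<theta>"
      using three_level_integral_mono[of \<epsilon> K r 0 \<theta> \<theta>] three_level_integral_mono[of \<epsilon> K r \<theta> 1 \<theta>] assms
      by (simp_all add: three_level_integral_def)
    ultimately have "0 < ?G \<theta>" "0 < ?G 1 - ?G \<theta>" by linarith+
    then show ?thesis
      using log_perspective_concave[of \<theta> "?G \<theta>" "1 - \<theta>" "?G 1 - ?G \<theta>" 1 1] assms
      by (simp add: split_cost_def)
  qed
  ultimately have ends: "?J \<theta> \<le> ?J 0" "?J \<theta> \<le> ?J 1" by auto
  \<comment> \<open>The condition \<open>piece\<close> says that neither kink lies strictly between
    \<open>p\<close> and \<open>q\<close>. As \<nu> is strictly inside, both weights are positive,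
    and strict excess at one end suffices.\<close>
  have strict: "?J (1 / 2) < ?J \<nu>"
    if "0 \<le> p" "p < \<nu>" "\<nu> < q" "q \<le> 1"
      and ge: "?J (1 / 2) \<le> ?J p" "?J (1 / 2) \<le> ?J q"
      and gt: "?J (1 / 2) < ?J p \<or> ?J (1 / 2) < ?J q"
      and piece: "q \<le> \<theta> \<or> \<theta> \<le> p" "q \<le> 1 / 2 \<or> 1 / 2 \<le> p"
    for p q
  proof -
    define s t where "s = (q - \<nu>) / (q - p)" and "t = (\<nu> - p) / (q - p)"
    have st: "0 < s" "0 < t" using that by (auto simp: s_def t_def)
    have sum: "s + t = 1" using that by (simp add: s_def t_def flip: add_divide_distrib)
    have "s * p + t * q = ((q - \<nu>) * p + (\<nu> - p) * q) / (q - p)"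
      by (simp add: s_def t_def add_divide_distrib)
    also have "(q - \<nu>) * p + (\<nu> - p) * q = \<nu> * (q - p)" by (simp add: algebra_simps)
    finally have "s * p + t * q = \<nu>" using that by simp
    have min_affine: "min (s * p + t * q) c = s * min p c + t * min q c" if "q \<le> c \<or> c \<le> p" for c
    proof (cases "q \<le> c")
      case True
      then show ?thesis using \<open>s * p + t * q = \<nu>\<close> \<open>p < \<nu>\<close> \<open>\<nu> < q\<close> by simp
    next
      case False
      then have "min (s * p + t * q) c = c" "min p c = c" "min q c = c" using that \<open>s * p + t * q = \<nu>\<close> \<open>p < \<nu>\<close> \<open>\<nu> < q\<close> by auto
      then show ?thesis using sum by (simp flip: distrib_right)
    qed
    have "?G (s * p + t * q) = s * ?G p + t * ?G q"
      unfolding three_level_integral_def min_affine[OF piece(1)] min_affine[OF piece(2)]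
      by (simp add: algebra_simps)
    then have concave: "s * ?J p + t * ?J q \<le> ?J \<nu>"
      using split_cost_concave[of \<epsilon> K r \<theta> p q s t] that assms st sum \<open>s * p + t * q = \<nu>\<close> by simp
    have "s * ?J (1 / 2) + t * ?J (1 / 2) < s * ?J p + t * ?J q"
      using gt
    proof
      assume "?J (1 / 2) < ?J p"
      then show ?thesis using st ge by (intro add_less_le_mono) auto
    next
      assume "?J (1 / 2) < ?J q"
      then show ?thesis using st ge by (intro add_le_less_mono) auto
    qed
    moreover have "s * ?J (1 / 2) + t * ?J (1 / 2) = ?J (1 / 2)"
      using sum by (simp flip: distrib_right)
    ultimately show ?thesis using concave by linarith
  qed
  \<comment> \<open>Every piece has an end point whose cost strictly exceeds that at 1/2: \<theta>
    on the first two pieces, 1 on the last, by \<open>ends\<close> and \<open>less\<close>.\<close>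
  consider "\<nu> < \<theta>" | "\<nu> = \<theta>" | "\<theta> < \<nu>" "\<nu> < 1 / 2" | "1 / 2 < \<nu>" using \<nu> by linarith
  then show ?thesis
  proof cases
    case 1
    then show ?thesis using assms ends by (intro strict[of 0 \<theta>]) auto
  next
    case 2
    then show ?thesis using less by simp
  next
    case 3
    then show ?thesis using assms by (intro strict[of \<theta> "1 / 2"]) auto
  next
    case 4
    then show ?thesis using assms ends by (intro strict[of "1 / 2" 1]) auto
  qed
qed

lemma split_objective_tendsto:
  assumes "0 < \<theta>" "\<theta> < 1 / 2" "0 < K" "0 < r" "0 < \<epsilon>" "0 < \<nu>" "\<nu> < 1"
  shows "(\<lambda>n. split_objective (three_level_series \<theta> K r) \<epsilon> n \<nu>) \<longlonglongrightarrow> split_cost \<theta> K r \<epsilon> \<nu>"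
proof -
  have pos: "limit_mean \<theta> K r a b + \<epsilon> > 0" if "a < b" for a b
    unfolding limit_mean_def using assms that
    by (intro add_pos_pos add_pos_nonneg mult_nonneg_nonneg fraction_below_nonneg) auto
  have "(\<lambda>n. split_objective (three_level_series \<theta> K r) \<epsilon> n \<nu>)
      \<longlonglongrightarrow> \<nu> * ln (limit_mean \<theta> K r 0 \<nu> + \<epsilon>) + (1 - \<nu>) * ln (limit_mean \<theta> K r \<nu> 1 + \<epsilon>)"
    unfolding split_objective_def using assms pos[of 0 \<nu>] pos[of \<nu> 1]
    by (intro tendsto_intros Sigma_hat_three_level_tendsto) auto
  \<comment> \<open>The regularized mean is the difference quotient of the integral, which turns the
    limit into perspectives.\<close>
  moreover have "limit_mean \<theta> K r a b + \<epsilon>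
      = (three_level_integral \<theta> K r \<epsilon> b - three_level_integral \<theta> K r \<epsilon> a) / (b - a)" if "a < b" for a b
  proof -
    have "three_level_integral \<theta> K r \<epsilon> b - three_level_integral \<theta> K r \<epsilon> a
        = (1 + \<epsilon>) * (b - a) + K * (min b (1 / 2) - min a (1 / 2)) + r * (min b \<theta> - min a \<theta>)"
      by (simp add: three_level_integral_def algebra_simps)
    then show ?thesis
      using that by (simp add: limit_mean_def fraction_below_def add_divide_distrib)
  qed
  moreover have "three_level_integral \<theta> K r \<epsilon> 0 = 0"
    using assms by (simp add: three_level_integral_def)
  ultimately show ?thesis
    using assms by (simp add: split_cost_def log_perspective_def)
qed

section \<open>Values at both splits and the unique minimizer\<close>

theorem proposition24:
  fixes \<theta> K r :: real and y :: "nat \<Rightarrow> nat \<Rightarrow> real"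
  assumes "0 < \<theta>" and "\<theta> < 1 / 2"
    and "0 < K" and "K < r"
  defines "y \<equiv> three_level_series \<theta> K r"
  shows "Delta_within y \<theta> = ereal K
       \<and> Delta_between y \<theta> = ereal r
       \<and> Delta_between y \<theta> / Delta_within y \<theta> = ereal (r / K)
       \<and> Delta_within y (1 / 2) = ereal r
       \<and> Delta_between y (1 / 2) = ereal K
       \<and> Delta_between y (1 / 2) / Delta_within y (1 / 2) = ereal (K / r)
       \<and> (Delta_between y \<theta> / Delta_within y \<theta> < ereal (1 / (2 * sqrt (\<theta> * (1 - \<theta>)))) \<longrightarrow>
            (\<forall>\<epsilon>>0.
               (\<forall>\<nu>\<in>{0<..<1}. convergent (\<lambda>n. split_objective y \<epsilon> n \<nu>))
             \<and> {\<nu>. is_arg_min (limit_objective y \<epsilon>) (\<lambda>\<nu>. \<nu> \<in> {0<..<1}) \<nu>} = {1 / 2}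
             \<and> limit_objective y \<epsilon> (1 / 2) < limit_objective y \<epsilon> \<theta>))"
proof -
  let ?S = "limit_mean \<theta> K r"
  have "0 < r" using assms by simp
  have lim: "(\<lambda>n. Sigma_hat y n a b) \<longlonglongrightarrow> ?S a b" if "0 \<le> a" "a < b" for a b
    unfolding y_def using assms that by (intro Sigma_hat_three_level_tendsto) auto
  have low: "?S a b = 1 + K + r" if "a < b" "b \<le> \<theta>" for a b
    using that assms by (simp add: limit_mean_def fraction_below_eq_1)
  have mid: "?S \<theta> (1 / 2) = 1 + K"
    using assms by (simp add: limit_mean_def fraction_below_eq_1 fraction_below_eq_0)
  have high: "?S a b = 1" if "1 / 2 \<le> a" "a < b" for a b
    using that assms by (simp add: limit_mean_def fraction_below_eq_0)
  \<comment> \<open>A window in the first half is fully covered by the \<open>K\<close> layer, so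
    only the share below \<theta> varies. Dually, for \<open>right\<close> the \<open>r\<close>
    layer is absent and only the share below 1/2 varies.\<close>
  have left: "?S a b \<in> {1 + K..1 + K + r}" if "a < b" "b \<le> 1 / 2" for a b
    using that \<open>0 < r\<close> fraction_below_nonneg[of a b \<theta>] fraction_below_le_1[of a b \<theta>]
    by (simp add: limit_mean_def fraction_below_eq_1 mult_left_le)
  have right: "?S a b \<in> {1..1 + K}" if "\<theta> \<le> a" "a < b" for a b
    using that \<open>0 < K\<close> fraction_below_nonneg[of a b "1 / 2"] fraction_below_le_1[of a b "1 / 2"]
    by (simp add: limit_mean_def fraction_below_eq_0 mult_left_le)
  have bot: "?S 0 \<theta> = 1 + K + r" and top: "?S (1 / 2) 1 = 1"
    using assms low[of 0 \<theta>] high[of "1 / 2" 1] by auto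
  have sub: "(0, \<theta>) \<in> subintervals 0 \<theta>" "(0, \<theta>) \<in> subintervals 0 (1 / 2)"
    "(\<theta>, 1 / 2) \<in> subintervals \<theta> 1" "(\<theta>, 1 / 2) \<in> subintervals 0 (1 / 2)"
    "(1 / 2, 1) \<in> subintervals \<theta> 1" "(1 / 2, 1) \<in> subintervals (1 / 2) 1"
    using assms(1,2) by (auto simp: subintervals_def)
  have within_theta: "Delta_within y \<theta> = ereal K"
  proof (rule Delta_within_eq[where S = ?S])
    \<comment> \<open>The mean is constant left of \<theta>; the interval is widened to length
      \<open>K\<close> to match the right side, where the difference \<open>K\<close> is
      attained.\<close>
    show "?S a b \<in> {1 + K + r..1 + K + r + K}" if "a < b" "b \<le> \<theta>" for a b
      using low[OF that] \<open>0 < K\<close> by simp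
    show "((\<theta>, 1 / 2), (1 / 2, 1)) \<in> subintervals 0 \<theta> \<times> subintervals 0 \<theta> \<union>
        subintervals \<theta> 1 \<times> subintervals \<theta> 1" using sub by blast
    show "\<bar>?S \<theta> (1 / 2) - ?S (1 / 2) 1\<bar> = K" using mid top \<open>0 < K\<close> by simp
    show "?S a b \<in> {1..1 + K}" if "\<theta> \<le> a" "a < b" for a b using right[OF that] .
  qed (use lim \<open>0 < \<theta>\<close> in auto)
  have between_theta: "Delta_between y \<theta> = ereal r"
  proof (rule Delta_between_eq[where S = ?S])
    show "1 + K + r \<le> ?S a b" if "a < b" "b \<le> \<theta>" for a b using low[OF that] by simp
    show "?S a b \<le> 1 + K" if "\<theta> \<le> a" "a < b" for a b using right[OF that] by simp
    show "((0, \<theta>), (\<theta>, 1 / 2)) \<in> subintervals 0 \<theta> \<times> subintervals \<theta> 1" using sub by blast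
    show "\<bar>?S 0 \<theta> - ?S \<theta> (1 / 2)\<bar> = r" using bot mid \<open>0 < r\<close> by simp
  qed (use lim \<open>0 < \<theta>\<close> in auto)
  have within_half: "Delta_within y (1 / 2) = ereal r"
  proof (rule Delta_within_eq[where S = ?S])
    show "?S a b \<in> {1..1 + r}" if "1 / 2 \<le> a" "a < b" for a b using high[OF that] \<open>0 < r\<close> by simp
    show "((0, \<theta>), (\<theta>, 1 / 2)) \<in> subintervals 0 (1 / 2) \<times> subintervals 0 (1 / 2) \<union>
        subintervals (1 / 2) 1 \<times> subintervals (1 / 2) 1" using sub by blast
    show "\<bar>?S 0 \<theta> - ?S \<theta> (1 / 2)\<bar> = r" using bot mid \<open>0 < r\<close> by simp
    show "?S a b \<in> {1 + K..1 + K + r}" if "a < b" "b \<le> 1 / 2" for a b using left[OF that] .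
  qed (use lim in auto)
  have between_half: "Delta_between y (1 / 2) = ereal K"
  proof (rule Delta_between_eq[where S = ?S])
    show "1 + K \<le> ?S a b" if "a < b" "b \<le> 1 / 2" for a b using left[OF that] by simp
    show "?S a b \<le> 1" if "1 / 2 \<le> a" "a < b" for a b using high[OF that] by simp
    show "((\<theta>, 1 / 2), (1 / 2, 1)) \<in> subintervals 0 (1 / 2) \<times> subintervals (1 / 2) 1"
      using sub by blast
    show "\<bar>?S \<theta> (1 / 2) - ?S (1 / 2) 1\<bar> = K" using mid top \<open>0 < K\<close> by simp
  qed (use lim in auto)
  have objective: "(\<forall>\<nu>\<in>{0<..<1}. convergent (\<lambda>n. split_objective y \<epsilon> n \<nu>))
      \<and> {\<nu>. is_arg_min (limit_objective y \<epsilon>) (\<lambda>\<nu>. \<nu> \<in> {0<..<1}) \<nu>} = {1 / 2}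
      \<and> limit_objective y \<epsilon> (1 / 2) < limit_objective y \<epsilon> \<theta>"
    if "r / K < 1 / (2 * sqrt (\<theta> * (1 - \<theta>)))" "0 < \<epsilon>" for \<epsilon>
  proof -
    have sqrt_pos: "0 < sqrt (\<theta> * (1 - \<theta>))" using assms by simp
    \<comment> \<open>Clearing denominators and squaring gives the root-free form needed to compare
      the costs at \<theta> and 1/2.\<close>
    then have "2 * sqrt (\<theta> * (1 - \<theta>)) * r < K" using that(1) assms by (simp add: field_simps)
    then have "(2 * sqrt (\<theta> * (1 - \<theta>)) * r)\<^sup>2 < K\<^sup>2"
      using sqrt_pos \<open>0 < r\<close> by (intro power_strict_mono) auto
    then have "4 * \<theta> * (1 - \<theta>) * r\<^sup>2 < K\<^sup>2" using assms by (simp add: power_mult_distrib)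
    then have less: "split_cost \<theta> K r \<epsilon> (1 / 2) < split_cost \<theta> K r \<epsilon> \<theta>"
      using assms that \<open>0 < r\<close> by (intro split_cost_half_less_theta) auto
    have tendsto: "(\<lambda>n. split_objective y \<epsilon> n \<nu>) \<longlonglongrightarrow> split_cost \<theta> K r \<epsilon> \<nu>" if "0 < \<nu>" "\<nu> < 1" for \<nu>
      unfolding y_def using assms that \<open>0 < \<epsilon>\<close> by (intro split_objective_tendsto) auto
    have eq: "limit_objective y \<epsilon> \<nu> = split_cost \<theta> K r \<epsilon> \<nu>" if "0 < \<nu>" "\<nu> < 1" for \<nu>
      unfolding limit_objective_def using tendsto[OF that] by (rule limI)
    have half: "limit_objective y \<epsilon> (1 / 2) < limit_objective y \<epsilon> \<nu>"
      if "0 < \<nu>" "\<nu> < 1" "\<nu> \<noteq> 1 / 2" for \<nu>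
      using split_cost_half_less[OF assms(1-3) \<open>0 < r\<close> \<open>0 < \<epsilon>\<close> less that] that by (simp add: eq)
    have "{\<nu>. is_arg_min (limit_objective y \<epsilon>) (\<lambda>\<nu>. \<nu> \<in> {0<..<1}) \<nu>} = {1 / 2}"
    proof (intro set_eqI iffI)
      fix \<nu> assume "\<nu> \<in> {\<nu>. is_arg_min (limit_objective y \<epsilon>) (\<lambda>\<nu>. \<nu> \<in> {0<..<1}) \<nu>}"
      then have "0 < \<nu>" "\<nu> < 1" "\<not> limit_objective y \<epsilon> (1 / 2) < limit_objective y \<epsilon> \<nu>"
        by (auto simp: is_arg_min_def)
      then show "\<nu> \<in> {1 / 2}" using half[of \<nu>] by blast
    next
      fix \<nu> :: real assume "\<nu> \<in> {1 / 2}"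
      then have "\<nu> = 1 / 2" by (rule singletonD)
      have "\<not> limit_objective y \<epsilon> \<mu> < limit_objective y \<epsilon> (1 / 2)"
        if "0 < \<mu>" "\<mu> < 1" for \<mu>
        using half[OF that] by fastforce
      then show "\<nu> \<in> {\<nu>. is_arg_min (limit_objective y \<epsilon>) (\<lambda>\<nu>. \<nu> \<in> {0<..<1}) \<nu>}"
        unfolding \<open>\<nu> = 1 / 2\<close> is_arg_min_def by auto
    qed
    moreover have "\<forall>\<nu>\<in>{0<..<1}. convergent (\<lambda>n. split_objective y \<epsilon> n \<nu>)"
      using convergentI[OF tendsto] by simp
    ultimately show ?thesis using half[of \<theta>] assms by auto
  qed
  \<comment> \<open>With the four values inserted, the extended-real quotients are quotients of
    positive reals, and the hypothesis becomes the one in \<open>objective\<close>.\<close>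
  show ?thesis
    using assms \<open>0 < r\<close> objective
    unfolding within_theta between_theta within_half between_half by simp
qed

end
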